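(* Let $\Phi=(G,\varphi)$ be a $\mathbb{T}$-gain graph on a connected bipartite graph $G$ with $n$ vertices, and let $\mu(G)$ be the matching number of $G$. Then $\mathcal{E}(\Phi)=2\mu(G)$ if and only if $\Phi\sim(K_{\frac{n}{2},\frac{n}{2}},1)$.
   Context: A $\mathbb{T}$-gain graph $\Phi=(G,\varphi)$ consists of a finite simple graph $G$ and a map $\varphi$ assigning to each orientation $\overrightarrow{e_{p,q}}$ of each edge $v_pv_q$ a value in $\mathbb{T}=\{z\in\mathbb{C}:|z|=1\}$, with $\varphi(\overrightarrow{e_{q,p}})=\varphi(\overrightarrow{e_{p,q}})^{-1}$. Its adjacency matrix $A(\Phi)$ is the Hermitian matrix whose $(p,q)$ entry is $\varphi(\overrightarrow{e_{p,q}})$ if $v_p\sim v_q$ and $0$ otherwise; $\mathcal{E}(\Phi)$ is the sum of absolute values of its eigenvalues. $\Phi\sim\Phi'$ means $A(\Phi')=UA(\Phi)U^*$ for a diagonal unitary $U$; $(H,1)$ is the gain graph on $H$ with all gains $1$. The matching number $\mu(G)$ is the maximum number of pairwise disjoint edges.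
   Formalization: The number of vertices n is assumed to be at least 2, since for the one-vertex graph both the energy and twice the matching number are 0 while K_{1/2,1/2} does not exist. *)

theory Defs
  imports
    "Jordan_Normal_Form.Schur_Decomposition"
    "Graph_Theory.Graph_Theory"
    "HOL-Library.Disjoint_Sets"
begin

text \<open>
  A simple graph is a \<^locale>\<open>pair_graph\<close>: a finite, loop-free, symmetric relation of arcs, in
  which the two arcs (p, q) and (q, p) are the two orientations of one edge.
  A gain graph on n vertices has vertex set {0, ..., n - 1}, and the vertices index the rows and
  columns of its adjacency matrix.
\<close>

type_synonym gain_graph = "nat pair_pre_digraph \<times> (nat \<times> nat \<Rightarrow> complex)"

text \<open>The gain function is constrained, and used, only on the arcs of the graph.\<close>

definition T_gain_graph :: "nat \<Rightarrow> gain_graph \<Rightarrow> bool" where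
  "T_gain_graph n \<Phi> \<longleftrightarrow> (case \<Phi> of (G, \<phi>) \<Rightarrow>
     pair_graph G \<and> pverts G = {0..<n} \<and>
     (\<forall>(p, q) \<in> parcs G. cmod (\<phi> (p, q)) = 1 \<and> \<phi> (q, p) = inverse (\<phi> (p, q))))"

definition adjacency_matrix :: "gain_graph \<Rightarrow> complex mat" where
  "adjacency_matrix \<Phi> = (case \<Phi> of (G, \<phi>) \<Rightarrow>
     mat (card (pverts G)) (card (pverts G))
       (\<lambda>(p, q). if (p, q) \<in> parcs G then \<phi> (p, q) else 0))"

text \<open>Eigenvalues are counted with their algebraic multiplicities.\<close>

definition energy :: "gain_graph \<Rightarrow> real" where
  "energy \<Phi> = (let A = adjacency_matrix \<Phi> in
     \<Sum>k | eigenvalue A k. real (Polynomial.order k (char_poly A)) * cmod k)"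

definition unitary_mat :: "complex mat \<Rightarrow> bool" where
  "unitary_mat U \<longleftrightarrow> square_mat U \<and>
     U * mat_adjoint U = 1\<^sub>m (dim_row U) \<and> mat_adjoint U * U = 1\<^sub>m (dim_row U)"

text \<open>
  Both gain graphs live on the same labelled vertices. A graph that is specified only up to
  isomorphism, such as a complete bipartite graph, has to be represented by one of its labelled
  copies on {0, ..., n - 1}.
\<close>

definition switching_equivalent :: "gain_graph \<Rightarrow> gain_graph \<Rightarrow> bool" (infix \<open>\<sim>\<^sub>s\<close> 50) where
  "\<Phi> \<sim>\<^sub>s \<Phi>' \<longleftrightarrow>
     (\<exists>U \<in> carrier_mat (dim_row (adjacency_matrix \<Phi>)) (dim_row (adjacency_matrix \<Phi>)).
        diagonal_mat U \<and> unitary_mat U \<and>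
        adjacency_matrix \<Phi>' = U * adjacency_matrix \<Phi> * mat_adjoint U)"

definition unit_gain :: "nat pair_pre_digraph \<Rightarrow> gain_graph" where
  "unit_gain H = (H, \<lambda>_. 1)"

definition bipartite :: "'a pair_pre_digraph \<Rightarrow> bool" where
  "bipartite G \<longleftrightarrow> (\<exists>X Y. pverts G = X \<union> Y \<and> X \<inter> Y = {} \<and>
     parcs G \<subseteq> X \<times> Y \<union> Y \<times> X)"

definition uedges :: "'a pair_pre_digraph \<Rightarrow> 'a set set" where
  "uedges G = {{u, v} | u v. (u, v) \<in> parcs G}"

definition matching :: "'a pair_pre_digraph \<Rightarrow> 'a set set \<Rightarrow> bool" where
  "matching G M \<longleftrightarrow> M \<subseteq> uedges G \<and> disjoint M"

definition matching_number :: "'a pair_pre_digraph \<Rightarrow> nat" where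
  "matching_number G = Max (card ` {M. matching G M})"

end

theory Submission
  imports Defs
begin

text \<open>
  Let \<open>A = \<Sum> l\<^sub>i w\<^sub>i w\<^sub>i*\<close> be a spectral decomposition of the adjacency matrix and let \<open>Q\<close> be
  the submatrix of \<open>A\<close> supported on a maximum matching \<open>M\<close>. As \<open>Q\<close> is a Hermitian contraction,
  \<open>2 |M| = tr (Q A) = \<Sum> l\<^sub>i \<langle>w\<^sub>i, Q w\<^sub>i\<rangle> \<le> \<Sum> |l\<^sub>i|\<close>, which is the energy. Equality forces
  \<open>Q w\<^sub>i = sgn (l\<^sub>i) w\<^sub>i\<close> whenever \<open>l\<^sub>i \<noteq> 0\<close>, hence \<open>Q A = |A|\<close> is positive semidefinite. Rows
  of \<open>A\<close> at unmatched vertices then vanish, so by connectedness \<open>M\<close> is perfect; \<open>Q A\<close> has unit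
  diagonal and entries of modulus \<open>0\<close> or \<open>1\<close>, so its support is an equivalence relation on which
  its entries are multiplicative. The class of a vertex together with the partners of that class
  is closed under adjacency, so it is everything; for bipartite \<open>G\<close> the class is one side, which
  makes \<open>G\<close> complete bipartite, and the multiplicativity provides the switching function.
\<close>

section \<open>The spectral theorem for Hermitian matrices\<close>

lemma dim_mat_adjoint [simp]: "dim_row (mat_adjoint A) = dim_col A" "dim_col (mat_adjoint A) = dim_row A"
  by (auto simp: mat_adjoint_def)

lemma mat_adjoint_carrier [simp]: "A \<in> carrier_mat n m \<Longrightarrow> mat_adjoint A \<in> carrier_mat m n"
  by (intro carrier_matI) simp_all

lemma index_mat_adjoint [simp]:
  fixes A :: "complex mat"
  shows "i < dim_col A \<Longrightarrow> j < dim_row A \<Longrightarrow> mat_adjoint A $$ (i, j) = cnj (A $$ (j, i))"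
  by (simp add: mat_adjoint_def mat_of_rows_def)

lemma mat_adjoint_mult:
  fixes A B :: "complex mat"
  assumes "A \<in> carrier_mat n m" "B \<in> carrier_mat m k"
  shows "mat_adjoint (A * B) = mat_adjoint B * mat_adjoint A"
  using assms by (intro eq_matI) (auto simp: scalar_prod_def mult.commute intro!: sum.cong)

lemma mat_adjoint_adjoint [simp]:
  fixes A :: "complex mat"
  shows "mat_adjoint (mat_adjoint A) = A"
  by (intro eq_matI) auto

lemma mat_adjoint_four_block:
  fixes A B C D :: "complex mat"
  assumes "A \<in> carrier_mat n1 m1" "B \<in> carrier_mat n1 m2" "C \<in> carrier_mat n2 m1" "D \<in> carrier_mat n2 m2"
  shows "mat_adjoint (four_block_mat A B C D) =
    four_block_mat (mat_adjoint A) (mat_adjoint C) (mat_adjoint B) (mat_adjoint D)"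
  using assms by (intro eq_matI) auto

text \<open>Gram-Schmidt on a basis headed by \<open>v\<close> keeps \<open>v\<close> as its first
  vector; normalising the columns rescales it, which is the factor \<open>c\<close>. The result is
  the change of basis that splits off an eigenvector.\<close>

lemma unitary_completion:
  fixes v :: "complex vec"
  assumes v: "v \<in> carrier_vec n" and v0: "v \<noteq> 0\<^sub>v n" and n: "n \<noteq> 0"
  obtains W c where "W \<in> carrier_mat n n" "mat_adjoint W * W = 1\<^sub>m n" "col W 0 = c \<cdot>\<^sub>v v"
proof -
  interpret cof_vec_space n "TYPE(complex)" .
  define b where "b = basis_completion v"
  define ws where "ws = gram_schmidt n b"
  from basis_completion[OF v v0, folded b_def]
  have b: "distinct b" "\<not> lin_dep (set b)" "set b \<subseteq> carrier_vec n" "hd b = v" "length b = n"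
    by auto
  then obtain vs where bv: "b = v # vs" using n by (cases b) auto
  from gram_schmidt_result[OF b(3,1,2) refl, folded ws_def]
  have ws: "set ws \<subseteq> carrier_vec n" "corthogonal ws" "length ws = n" by (auto simp: b)
  from gram_schmidt_hd[OF v, of vs, folded bv] have "hd ws = v" by (simp add: ws_def)
  with ws n have ws0: "ws ! 0 = v" by (metis hd_conv_nth length_0_conv)
  have wsn: "dim_vec (ws ! j) = n" if "j < n" for j using ws that by (metis carrier_vecD nth_mem subsetD)
  \<comment> \<open>The Gram-Schmidt vectors are orthogonal and nonzero but not normalised;
    \<open>r j\<close> is the norm by which column \<open>j\<close> of \<open>W\<close> is
    divided.\<close>
  define r where "r j = sqrt (\<Sum>k<n. (cmod (ws ! j $ k))\<^sup>2)" for j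
  define W where "W = mat n n (\<lambda>(i, j). ws ! j $ i / of_real (r j))"
  have sp: "ws ! i \<bullet>c ws ! j = (\<Sum>k<n. cnj (ws ! j $ k) * ws ! i $ k)" if "i < n" "j < n" for i j
    using that by (simp add: scalar_prod_def wsn atLeast0LessThan mult.commute)
  have r2: "complex_of_real ((r j)\<^sup>2) = ws ! j \<bullet>c ws ! j" if "j < n" for j
    unfolding r_def sp[OF that that]
    by (simp add: sum_nonneg complex_norm_square mult.commute del: of_real_power)
  have r0: "r j \<noteq> 0" if "j < n" for j
    using corthogonalD[OF ws(2), of j j] ws(3) that r2[OF that] by auto
  have "mat_adjoint W * W = 1\<^sub>m n"
  proof (intro eq_matI)
    fix i j assume "i < dim_row (1\<^sub>m n :: complex mat)" "j < dim_col (1\<^sub>m n :: complex mat)"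
    then have ij: "i < n" "j < n" by auto
    have "(mat_adjoint W * W) $$ (i, j) =
       (\<Sum>k<n. cnj (ws ! i $ k / of_real (r i)) * (ws ! j $ k / of_real (r j)))"
      using ij by (simp add: W_def scalar_prod_def atLeast0LessThan)
    also have "\<dots> = (ws ! j \<bullet>c ws ! i) / (of_real (r i) * of_real (r j))"
      using ij by (simp add: sp sum_divide_distrib)
    also have "\<dots> = 1\<^sub>m n $$ (i, j)"
      using ij corthogonalD[OF ws(2), of j i] ws(3) r2[OF ij(1)] r0[OF ij(1)]
      by (auto simp: power2_eq_square)
    finally show "(mat_adjoint W * W) $$ (i, j) = 1\<^sub>m n $$ (i, j)" .
  qed (auto simp: W_def)
  moreover have "col W 0 = (1 / of_real (r 0)) \<cdot>\<^sub>v v"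
    using n v by (intro eq_vecI) (auto simp: W_def ws0)
  ultimately show thesis using that[of W] by (auto simp: W_def)
qed

text \<open>Induction on the dimension by deflation: in a unitary basis whose first vector is an
  eigenvector, a Hermitian matrix is block diagonal, and its lower block is again Hermitian.\<close>

theorem hermitian_spectral:
  fixes A :: "complex mat"
  assumes "A \<in> carrier_mat n n" "mat_adjoint A = A"
  shows "\<exists>P D. P \<in> carrier_mat n n \<and> D \<in> carrier_mat n n \<and> mat_adjoint P * P = 1\<^sub>m n \<and>
    diagonal_mat D \<and> A = P * D * mat_adjoint P"
  using assms
proof (induction n arbitrary: A)
  case 0
  then show ?case by (intro exI[of _ "1\<^sub>m 0"]) (auto simp: diagonal_mat_def intro!: eq_matI)
next
  case (Suc n)
  note A = Suc.prems(1)
  let ?N = "Suc n"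
  have "degree (char_poly A) \<noteq> 0" using degree_monic_char_poly[OF A] by auto
  then obtain e where "poly (char_poly A) e = 0"
    using fundamental_theorem_of_algebra constant_degree by metis
  then have "eigenvalue A e" using eigenvalue_root_char_poly[OF A] by simp
  then obtain v where v: "v \<in> carrier_vec ?N" "v \<noteq> 0\<^sub>v ?N" "A *\<^sub>v v = e \<cdot>\<^sub>v v"
    using A unfolding eigenvalue_def eigenvector_def by auto
  obtain W c where W: "W \<in> carrier_mat ?N ?N" "mat_adjoint W * W = 1\<^sub>m ?N" "col W 0 = c \<cdot>\<^sub>v v"
    using unitary_completion[OF v(1,2)] by auto
  let ?W = "mat_adjoint W"
  have W': "?W \<in> carrier_mat ?N ?N" using W by simp
  have WW: "W * ?W = 1\<^sub>m ?N" using mat_mult_left_right_inverse[OF W' W(1)] W by auto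
  note asc = assoc_mult_mat[of _ ?N ?N _ ?N _ ?N] mult_carrier_mat[of _ ?N ?N _ ?N]
  define B where "B = ?W * A * W"
  have B: "B \<in> carrier_mat ?N ?N" unfolding B_def by (intro carrier_matI) (use W A in auto)
  have Badj: "mat_adjoint B = B"
    using W W' A Suc.prems(2) by (simp add: B_def asc mat_adjoint_mult[of _ ?N ?N _ ?N])
  have AB: "A = W * B * ?W"
  proof -
    have "W * B * ?W = (W * ?W) * A * (W * ?W)"
      using W W' A by (simp add: B_def asc)
    then show ?thesis using A by (simp add: WW)
  qed
  \<comment> \<open>The first column of \<open>A * W\<close> is \<open>e\<close> times that of
    \<open>W\<close>, and \<open>mat_adjoint W * W\<close> is the identity.\<close>
  have col0: "B $$ (i, 0) = (if i = 0 then e else 0)" if "i < ?N" for i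
  proof -
    have "A *\<^sub>v col W 0 = e \<cdot>\<^sub>v col W 0"
      using A v W by (simp add: mult_mat_vec[OF A] smult_smult_assoc mult.commute)
    moreover have "col (A * W) 0 = A *\<^sub>v col W 0" by (rule col_mult2[OF A W(1)]) simp
    ultimately have "col (A * W) 0 = e \<cdot>\<^sub>v col W 0" by (simp only:)
    moreover have "B $$ (i, 0) = row ?W i \<bullet> col (A * W) 0"
      using that A W W' by (simp add: B_def asc)
    moreover have "row ?W i \<bullet> col W 0 = (1\<^sub>m ?N :: complex mat) $$ (i, 0)"
      using that W(1) W' by (subst W(2)[symmetric]) simp
    ultimately show ?thesis using that W(1) W' by auto
  qed
  \<comment> \<open>Hermitian symmetry carries the zeros of the first column over to the first
    row.\<close>
  have row0: "B $$ (0, j) = (if j = 0 then e else 0)" if "j < ?N" for j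
  proof -
    have "B $$ (0, j) = cnj (B $$ (j, 0))" using B that by (subst Badj[symmetric]) simp
    moreover have "B $$ (0, 0) = e" using col0 by simp
    ultimately show ?thesis using col0[OF that] by auto
  qed
  define E where "E = mat 1 1 (\<lambda>_. e)"
  define C where "C = mat n n (\<lambda>(i, j). B $$ (Suc i, Suc j))"
  have EC: "E \<in> carrier_mat 1 1" "C \<in> carrier_mat n n" by (auto simp: E_def C_def)
  have Bb: "B = four_block_mat E (0\<^sub>m 1 n) (0\<^sub>m n 1) C"
    using B col0 row0 by (intro eq_matI) (auto simp: E_def C_def)
  have "mat_adjoint C = C"
  proof (intro eq_matI)
    fix i j assume ij: "i < dim_row C" "j < dim_col C"
    then have "B $$ (Suc i, Suc j) = cnj (B $$ (Suc j, Suc i))"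
      using B by (subst Badj[symmetric]) (simp add: C_def)
    then show "mat_adjoint C $$ (i, j) = C $$ (i, j)" using ij by (simp add: C_def)
  qed (auto simp: C_def)
  from Suc.IH[OF EC(2) this] obtain P D where PD: "P \<in> carrier_mat n n" "D \<in> carrier_mat n n"
    "mat_adjoint P * P = 1\<^sub>m n" "diagonal_mat D" "C = P * D * mat_adjoint P" by auto
  have mult: "four_block_mat X (0\<^sub>m 1 n) (0\<^sub>m n 1) Y * four_block_mat X' (0\<^sub>m 1 n) (0\<^sub>m n 1) Y' =
      four_block_mat (X * X') (0\<^sub>m 1 n) (0\<^sub>m n 1) (Y * Y')"
    if "X \<in> carrier_mat 1 1" "X' \<in> carrier_mat 1 1" "Y \<in> carrier_mat n n" "Y' \<in> carrier_mat n n"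
    for X X' Y Y' :: "complex mat"
    using that by (subst mult_four_block_mat[of _ 1 1 _ n _ n _ _ 1 _ n]) simp_all
  \<comment> \<open>The diagonalisation of the lower block, padded by the eigenvalue
    \<open>e\<close>; \<open>W * P'\<close> then diagonalises \<open>A\<close>.\<close>
  define P' where "P' = four_block_mat (1\<^sub>m 1) (0\<^sub>m 1 n) (0\<^sub>m n 1) P"
  define D' where "D' = four_block_mat E (0\<^sub>m 1 n) (0\<^sub>m n 1) D"
  have car: "P' \<in> carrier_mat ?N ?N" "D' \<in> carrier_mat ?N ?N"
    using four_block_carrier_mat[OF one_carrier_mat PD(1), of 1]
      four_block_carrier_mat[OF EC(1) PD(2)] by (simp_all add: P'_def D'_def)
  have adj1: "mat_adjoint (1\<^sub>m k) = (1\<^sub>m k :: complex mat)" for k by (intro eq_matI) auto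
  have adj0: "mat_adjoint (0\<^sub>m k l) = (0\<^sub>m l k :: complex mat)" for k l by (intro eq_matI) auto
  have aP: "mat_adjoint P' = four_block_mat (1\<^sub>m 1) (0\<^sub>m 1 n) (0\<^sub>m n 1) (mat_adjoint P)"
    unfolding P'_def
    by (subst mat_adjoint_four_block[OF one_carrier_mat zero_carrier_mat zero_carrier_mat PD(1)]) (simp_all add: adj1 adj0)
  have PP: "mat_adjoint P' * P' = 1\<^sub>m ?N"
    unfolding aP unfolding P'_def by (subst mult) (use PD(1,3) in simp_all)
  have BP: "B = P' * D' * mat_adjoint P'"
  proof -
    have "P' * D' = four_block_mat (1\<^sub>m 1 * E) (0\<^sub>m 1 n) (0\<^sub>m n 1) (P * D)"
      unfolding P'_def D'_def by (rule mult) (use PD(1,2) EC in simp_all)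
    then have "P' * D' * mat_adjoint P' =
        four_block_mat (1\<^sub>m 1 * E * 1\<^sub>m 1) (0\<^sub>m 1 n) (0\<^sub>m n 1) (P * D * mat_adjoint P)"
      unfolding aP by (simp only:) (rule mult, use PD(1,2) EC in \<open>simp_all add: mult_carrier_mat[of _ n n _ n]\<close>)
    then show ?thesis using EC by (simp add: Bb PD(5)[symmetric])
  qed
  show ?case
  proof (intro exI conjI)
    show "W * P' \<in> carrier_mat ?N ?N" "D' \<in> carrier_mat ?N ?N" using car W by auto
    have "?W * (W * P') = P'"
      using W(1) W' car by (subst assoc_mult_mat[symmetric, of _ ?N ?N _ ?N _ ?N]) (simp_all add: W(2))
    then show "mat_adjoint (W * P') * (W * P') = 1\<^sub>m ?N"
      using W(1) W' car PP by (simp add: asc mat_adjoint_mult[of _ ?N ?N _ ?N])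
    show "diagonal_mat D'" using PD EC by (auto simp: diagonal_mat_def D'_def)
    show "A = W * P' * D' * mat_adjoint (W * P')"
      using W W' car by (subst AB, subst BP) (simp add: asc mat_adjoint_mult[of _ ?N ?N _ ?N])
  qed
qed

section \<open>Spectral data in coordinates and the energy as a sum over indices\<close>

text \<open>\<open>w i p\<close> is entry \<open>p\<close> of the \<open>i\<close>-th unit
  eigenvector. Taking \<open>l\<close> real makes \<open>expand\<close> encode that \<open>A\<close>
  is Hermitian.\<close>

locale eigensystem =
  fixes n :: nat and A :: "complex mat" and w :: "nat \<Rightarrow> nat \<Rightarrow> complex" and l :: "nat \<Rightarrow> real"
  assumes norm_w: "i < n \<Longrightarrow> (\<Sum>p<n. (cmod (w i p))\<^sup>2) = 1"
    and eigen: "i < n \<Longrightarrow> p < n \<Longrightarrow> (\<Sum>q<n. A $$ (p, q) * w i q) = of_real (l i) * w i p"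
    and expand: "p < n \<Longrightarrow> q < n \<Longrightarrow> A $$ (p, q) = (\<Sum>i<n. of_real (l i) * w i p * cnj (w i q))"

lemma order_prod_linear:
  fixes d :: "nat \<Rightarrow> complex"
  shows "Polynomial.order k (\<Prod>i<n. [:- d i, 1:]) = card {i. i < n \<and> d i = k}"
proof (induction n)
  case (Suc n)
  have "{i. i < Suc n \<and> d i = k} = {i. i < n \<and> d i = k} \<union> (if d n = k then {n} else {})"
    by (auto simp: less_Suc_eq)
  then have "card {i. i < Suc n \<and> d i = k} = card {i. i < n \<and> d i = k} + (if d n = k then 1 else 0)"
    by auto
  moreover have "Polynomial.order k (\<Prod>i<Suc n. [:- d i, 1:]) =
     Polynomial.order k (\<Prod>i<n. [:- d i, 1:]) + Polynomial.order k [:- d n, 1:]"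
    unfolding prod.lessThan_Suc by (rule order_mult, intro no_zero_divisors) auto
  moreover have "Polynomial.order k [:- d n, 1:] = (if d n = k then 1 else 0)"
    using order_linear_power[of k "- d n" 1] by auto
  ultimately show ?case using Suc.IH by simp
qed simp

text \<open>Grouping the indices by the value of \<open>d\<close>: each root \<open>k\<close> is hit
  by as many indices as its algebraic multiplicity.\<close>

lemma sum_eigenvalues_order:
  fixes d :: "nat \<Rightarrow> complex"
  assumes A: "A \<in> carrier_mat n n" and cp: "char_poly A = (\<Prod>i<n. [:- d i, 1:])"
  shows "(\<Sum>k | eigenvalue A k. real (Polynomial.order k (char_poly A)) * cmod k) = (\<Sum>i<n. cmod (d i))"
proof -
  have ev: "{k. eigenvalue A k} = d ` {..<n}"
    by (auto simp: eigenvalue_root_char_poly[OF A] cp poly_prod)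
  have "(\<Sum>i<n. cmod (d i)) = (\<Sum>k\<in>d ` {..<n}. \<Sum>i | i \<in> {..<n} \<and> d i = k. cmod (d i))"
    by (rule sum.image_gen) simp
  also have "\<dots> = (\<Sum>k\<in>d ` {..<n}. real (card {i. i < n \<and> d i = k}) * cmod k)"
    by (intro sum.cong) auto
  finally show ?thesis by (simp add: ev cp order_prod_linear)
qed

text \<open>The columns of the unitary \<open>P\<close> serve as eigenvectors, and similarity to
  \<open>D\<close> makes the diagonal of \<open>D\<close> the list of roots of the characteristic
  polynomial with multiplicity.\<close>

lemma hermitian_eigensystem:
  assumes A: "A \<in> carrier_mat n n" and herm: "mat_adjoint A = A"
  obtains w l where "eigensystem n A w l"
    and "(\<Sum>k | eigenvalue A k. real (Polynomial.order k (char_poly A)) * cmod k) = (\<Sum>i<n. \<bar>l i\<bar>)"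
proof -
  obtain P D where P: "P \<in> carrier_mat n n" and D: "D \<in> carrier_mat n n"
    and PP: "mat_adjoint P * P = 1\<^sub>m n" and diag: "diagonal_mat D" and APD: "A = P * D * mat_adjoint P"
    using hermitian_spectral[OF A herm] by auto
  have P': "mat_adjoint P \<in> carrier_mat n n" using P by simp
  have PP': "P * mat_adjoint P = 1\<^sub>m n" using mat_mult_left_right_inverse[OF P' P PP] .
  define w where "w i p = P $$ (p, i)" for i p
  define d where "d i = D $$ (i, i)" for i
  have D0: "D $$ (i, j) = (if i = j then d i else 0)" if "i < n" "j < n" for i j
    using diag D that by (auto simp: diagonal_mat_def d_def)
  have PD: "(P * D) $$ (p, j) = w j p * d j" if "p < n" "j < n" for p j
  proof -
    have "(P * D) $$ (p, j) = (\<Sum>k<n. P $$ (p, k) * D $$ (k, j))"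
      using P D that by (simp add: scalar_prod_def atLeast0LessThan)
    also have "\<dots> = (\<Sum>k<n. if k = j then P $$ (p, j) * d j else 0)"
      using that by (intro sum.cong) (auto simp: D0)
    finally show ?thesis using that by (simp add: w_def)
  qed
  have AP: "A * P = P * D"
    using P D P' PP by (simp add: APD assoc_mult_mat[of _ n n _ n _ n] mult_carrier_mat[of _ n n _ n])
  have orth: "(\<Sum>p<n. cnj (w i p) * w j p) = (if i = j then 1 else 0)" if "i < n" "j < n" for i j
  proof -
    have "(mat_adjoint P * P) $$ (i, j) = (\<Sum>p<n. cnj (w i p) * w j p)"
      using P that by (simp add: scalar_prod_def atLeast0LessThan w_def)
    then show ?thesis using that PP by simp
  qed
  have eig: "(\<Sum>q<n. A $$ (p, q) * w i q) = d i * w i p" if "i < n" "p < n" for i p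
  proof -
    have "(A * P) $$ (p, i) = (\<Sum>q<n. A $$ (p, q) * w i q)"
      using A P that by (simp add: scalar_prod_def atLeast0LessThan w_def)
    then show ?thesis using PD[of p i] that by (simp add: AP mult.commute)
  qed
  have ex: "A $$ (p, q) = (\<Sum>i<n. d i * w i p * cnj (w i q))" if "p < n" "q < n" for p q
  proof -
    have "((P * D) * mat_adjoint P) $$ (p, q) = (\<Sum>i<n. (P * D) $$ (p, i) * mat_adjoint P $$ (i, q))"
      using P D that by (simp add: scalar_prod_def atLeast0LessThan)
    then show ?thesis using P that by (simp add: APD PD w_def mult.commute)
  qed
  have hermA: "cnj (A $$ (p, q)) = A $$ (q, p)" if "p < n" "q < n" for p q
    using A that by (subst (2) herm[symmetric]) simp
  \<comment> \<open>\<open>?r\<close> is the Rayleigh quotient of the unit vector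
    \<open>w i\<close>; it equals \<open>d i\<close>, and Hermitian symmetry makes it its own
    conjugate.\<close>
  have real: "cnj (d i) = d i" if i: "i < n" for i
  proof -
    let ?r = "\<Sum>p<n. cnj (w i p) * (\<Sum>q<n. A $$ (p, q) * w i q)"
    have r: "?r = d i"
      using orth[OF i i] i by (simp add: eig sum_distrib_left[symmetric] mult.left_commute)
    have "cnj ?r = (\<Sum>p<n. \<Sum>q<n. w i p * A $$ (q, p) * cnj (w i q))"
      by (simp add: hermA sum_distrib_left mult.assoc)
    also have "\<dots> = (\<Sum>q<n. \<Sum>p<n. w i p * A $$ (q, p) * cnj (w i q))" by (rule sum.swap)
    also have "\<dots> = ?r" by (simp add: sum_distrib_left mult_ac)
    finally show ?thesis by (simp add: r)
  qed
  then have dl: "d i = of_real (Re (d i))" if "i < n" for i using that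
    by (metis Reals_cnj_iff complex_is_Real_iff of_real_Re)
  have "similar_mat A D"
    by (rule similar_matI[of _ _ P "mat_adjoint P" n]) (use P D P' PP PP' A APD in blast)+
  then have "char_poly A = (\<Prod>a\<leftarrow>diag_mat D. [:- a, 1:])"
    using char_poly_similar char_poly_upper_triangular[OF D] diag D
    by (metis diagonal_mat_def upper_triangular_def carrier_matD less_imp_neq less_trans)
  also have "\<dots> = (\<Prod>i<n. [:- d i, 1:])"
    using D by (simp add: diag_mat_def d_def comp_def prod.distinct_set_conv_list[symmetric] atLeast0LessThan)
  finally have cp: "char_poly A = (\<Prod>i<n. [:- d i, 1:])" .
  show thesis
  proof (rule that)
    show "eigensystem n A w (\<lambda>i. Re (d i))"
    proof
      fix i assume i: "i < n"
      have "of_real (\<Sum>p<n. (cmod (w i p))\<^sup>2) = (1 :: complex)"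
        using orth[OF i i] by (simp add: complex_norm_square mult.commute del: of_real_power)
      then show "(\<Sum>p<n. (cmod (w i p))\<^sup>2) = 1" using of_real_eq_1_iff by blast
    qed (use eig ex dl in auto)
    show "(\<Sum>k | eigenvalue A k. real (Polynomial.order k (char_poly A)) * cmod k) = (\<Sum>i<n. \<bar>Re (d i)\<bar>)"
      unfolding sum_eigenvalues_order[OF A cp] by (intro sum.cong refl) (metis dl lessThan_iff norm_of_real)
  qed
qed

context eigensystem
begin

lemma hermitian: "p < n \<Longrightarrow> q < n \<Longrightarrow> cnj (A $$ (p, q)) = A $$ (q, p)"
  by (simp add: expand mult_ac)

text \<open>Both sides are the trace of the square of \<open>A\<close>: \<open>expand\<close> is
  inserted for one factor and \<open>eigen\<close> is applied to the other.\<close>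

lemma sum_eigenvalues_sq: "(\<Sum>i<n. (l i)\<^sup>2) = (\<Sum>p<n. \<Sum>q<n. (cmod (A $$ (p, q)))\<^sup>2)"
proof -
  have "complex_of_real (\<Sum>p<n. \<Sum>q<n. (cmod (A $$ (p, q)))\<^sup>2) = (\<Sum>p<n. \<Sum>q<n. A $$ (p, q) * A $$ (q, p))"
    by (simp add: complex_norm_square hermitian del: of_real_power)
  also have "\<dots> = (\<Sum>p<n. \<Sum>q<n. \<Sum>i<n. A $$ (p, q) * (of_real (l i) * w i q * cnj (w i p)))"
    by (simp add: expand[where p = "_" and q = "_"] sum_distrib_left)
  also have "\<dots> = (\<Sum>i<n. \<Sum>p<n. \<Sum>q<n. A $$ (p, q) * (of_real (l i) * w i q * cnj (w i p)))"
    by (subst sum.swap[of _ "{..<n}"], subst (2) sum.swap) simp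
  also have "\<dots> = (\<Sum>i<n. \<Sum>p<n. of_real (l i) * cnj (w i p) * (\<Sum>q<n. A $$ (p, q) * w i q))"
    by (simp add: sum_distrib_left mult_ac)
  also have "\<dots> = (\<Sum>i<n. of_real ((l i)\<^sup>2) * of_real (\<Sum>p<n. (cmod (w i p))\<^sup>2))"
  proof (intro sum.cong refl)
    fix i assume "i \<in> {..<n}"
    then have "(\<Sum>p<n. of_real (l i) * cnj (w i p) * (\<Sum>q<n. A $$ (p, q) * w i q)) =
        (\<Sum>p<n. of_real (l i) * cnj (w i p) * (of_real (l i) * w i p))"
      by (simp add: eigen)
    also have "\<dots> = of_real ((l i)\<^sup>2) * (\<Sum>p<n. of_real ((cmod (w i p))\<^sup>2))"
      by (simp add: sum_distrib_left complex_norm_square power2_eq_square[of "complex_of_real (l i)"] mult_ac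
          del: of_real_power)
        (simp add: power2_eq_square mult_ac)
    finally show "(\<Sum>p<n. of_real (l i) * cnj (w i p) * (\<Sum>q<n. A $$ (p, q) * w i q)) =
        of_real ((l i)\<^sup>2) * of_real (\<Sum>p<n. (cmod (w i p))\<^sup>2)" by (simp del: of_real_power)
  qed
  also have "\<dots> = of_real (\<Sum>i<n. (l i)\<^sup>2)" by (simp add: norm_w)
  finally show ?thesis using of_real_eq_iff by metis
qed

end

section \<open>Partial involutions and the trace bound\<close>

text \<open>\<open>T\<close> stands for the vertices covered by a matching and \<open>s\<close> for
  the map to the partner. As an involution, \<open>s\<close> can be used to reindex sums over
  \<open>T\<close>.\<close>

locale eigensystem_matching = eigensystem +
  fixes T :: "nat set" and s :: "nat \<Rightarrow> nat"
  assumes T_sub: "T \<subseteq> {..<n}"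
    and s_in: "p \<in> T \<Longrightarrow> s p \<in> T"
    and s_s: "p \<in> T \<Longrightarrow> s (s p) = p"
    and unit: "p \<in> T \<Longrightarrow> cmod (A $$ (p, s p)) = 1"
begin

text \<open>\<open>Q i\<close> is the image of the eigenvector \<open>w i\<close> under the part of \<open>A\<close> supported on the
  pairs \<open>(p, s p)\<close>, which is a contraction.\<close>

definition Q :: "nat \<Rightarrow> nat \<Rightarrow> complex" where
  "Q i p = (if p \<in> T then A $$ (p, s p) * w i (s p) else 0)"

lemma sum_Q: "(\<Sum>p<n. f p * Q i p) = (\<Sum>p\<in>T. f p * (A $$ (p, s p) * w i (s p)))"
proof -
  have "(\<Sum>p<n. f p * Q i p) = (\<Sum>p\<in>T. f p * Q i p)"
    using T_sub by (intro sum.mono_neutral_right) (auto simp: Q_def)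
  then show ?thesis by (simp add: Q_def)
qed

text \<open>The entries used have modulus 1 and \<open>s\<close> permutes \<open>T\<close>, so the
  left side is the squared norm of \<open>w i\<close> restricted to \<open>T\<close>.\<close>

lemma norm_Q: assumes "i < n" shows "(\<Sum>p<n. (cmod (Q i p))\<^sup>2) \<le> 1"
proof -
  have "(\<Sum>p<n. (cmod (Q i p))\<^sup>2) = (\<Sum>p\<in>T. (cmod (Q i p))\<^sup>2)"
    using T_sub by (intro sum.mono_neutral_right) (auto simp: Q_def)
  also have "\<dots> = (\<Sum>p\<in>T. (cmod (w i (s p)))\<^sup>2)"
    by (simp add: Q_def norm_mult unit)
  also have "\<dots> = (\<Sum>p\<in>T. (cmod (w i p))\<^sup>2)"
    by (rule sum.reindex_bij_witness[of _ s s]) (auto simp: s_in s_s)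
  also have "\<dots> \<le> (\<Sum>p<n. (cmod (w i p))\<^sup>2)"
    using T_sub by (intro sum_mono2) auto
  finally show ?thesis using norm_w[OF assms] by simp
qed

text \<open>After the sums are swapped, \<open>expand\<close> collapses the sum over
  \<open>i\<close>: each \<open>p\<close> in \<open>T\<close> contributes
  \<open>A $$ (p, s p) * A $$ (s p, p)\<close>, which is 1.\<close>

lemma trace_Q: "(\<Sum>i<n. of_real (l i) * (\<Sum>p<n. cnj (w i p) * Q i p)) = (of_nat (card T) :: complex)"
proof -
  have "(\<Sum>i<n. of_real (l i) * (\<Sum>p<n. cnj (w i p) * Q i p)) =
      (\<Sum>i<n. \<Sum>p\<in>T. A $$ (p, s p) * (of_real (l i) * w i (s p) * cnj (w i p)))"
    by (simp add: sum_Q sum_distrib_left mult_ac)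
  also have "\<dots> = (\<Sum>p\<in>T. \<Sum>i<n. A $$ (p, s p) * (of_real (l i) * w i (s p) * cnj (w i p)))"
    by (rule sum.swap)
  also have "\<dots> = (\<Sum>p\<in>T. 1)"
  proof (intro sum.cong refl)
    fix p assume p: "p \<in> T"
    then have pn: "p < n" "s p < n" using T_sub s_in by blast+
    have "(\<Sum>i<n. A $$ (p, s p) * (of_real (l i) * w i (s p) * cnj (w i p))) = A $$ (p, s p) * A $$ (s p, p)"
      by (subst (2) expand) (use pn in \<open>simp_all add: sum_distrib_left\<close>)
    also have "\<dots> = of_real ((cmod (A $$ (p, s p)))\<^sup>2)"
      using hermitian[OF pn] by (simp only: complex_norm_square)
    finally show "(\<Sum>i<n. A $$ (p, s p) * (of_real (l i) * w i (s p) * cnj (w i p))) = 1"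
      by (simp add: unit p)
  qed
  finally show ?thesis by simp
qed

lemma cmod_diff_sgn_sq:
  "(cmod (a - of_real e * b))\<^sup>2 = (cmod a)\<^sup>2 + e\<^sup>2 * (cmod b)\<^sup>2 - 2 * e * Re (cnj a * b)"
  unfolding cmod_power2 by (simp add: power2_eq_square algebra_simps)

text \<open>Since \<open>w i\<close> is a unit vector and \<open>Q i\<close> has norm at most 1, the
  squared distance from \<open>w i\<close> to \<open>sgn (l i) Q i\<close> is at most
  \<open>2 - 2 sgn (l i) Re <w i, Q i>\<close>. Weighting by \<open>|l i|\<close> and summing brings
  in \<open>trace_Q\<close>. The left side is nonnegative, so this is the trace bound with an
  explicit remainder.\<close>

lemma slack:
  "(\<Sum>i<n. \<bar>l i\<bar> * (\<Sum>p<n. (cmod (w i p - of_real (sgn (l i)) * Q i p))\<^sup>2)) \<le> 2 * ((\<Sum>i<n. \<bar>l i\<bar>) - card T)"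
proof -
  let ?r = "\<lambda>i. Re (\<Sum>p<n. cnj (w i p) * Q i p)"
  have "\<bar>l i\<bar> * (\<Sum>p<n. (cmod (w i p - of_real (sgn (l i)) * Q i p))\<^sup>2) \<le> 2 * \<bar>l i\<bar> - 2 * (l i * ?r i)"
    if i: "i < n" for i
  proof -
    have "(\<Sum>p<n. (cmod (w i p - of_real (sgn (l i)) * Q i p))\<^sup>2) =
        1 + (sgn (l i))\<^sup>2 * (\<Sum>p<n. (cmod (Q i p))\<^sup>2) - 2 * sgn (l i) * ?r i"
      unfolding cmod_diff_sgn_sq by (simp add: sum.distrib sum_subtractf norm_w[OF i] flip: sum_distrib_left)
    also have "(sgn (l i))\<^sup>2 * (\<Sum>p<n. (cmod (Q i p))\<^sup>2) \<le> 1"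
      using norm_Q[OF i] by (auto simp: sgn_if)
    finally have "(\<Sum>p<n. (cmod (w i p - of_real (sgn (l i)) * Q i p))\<^sup>2) \<le> 2 - 2 * sgn (l i) * ?r i" by simp
    then have "\<bar>l i\<bar> * (\<Sum>p<n. (cmod (w i p - of_real (sgn (l i)) * Q i p))\<^sup>2) \<le> \<bar>l i\<bar> * (2 - 2 * sgn (l i) * ?r i)"
      by (intro mult_left_mono) auto
    also have "\<dots> = 2 * \<bar>l i\<bar> - 2 * ((\<bar>l i\<bar> * sgn (l i)) * ?r i)" by (simp add: algebra_simps)
    finally show ?thesis by (simp only: abs_mult_sgn)
  qed
  then have "(\<Sum>i<n. \<bar>l i\<bar> * (\<Sum>p<n. (cmod (w i p - of_real (sgn (l i)) * Q i p))\<^sup>2)) \<le>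
      (\<Sum>i<n. 2 * \<bar>l i\<bar> - 2 * (l i * ?r i))"
    by (intro sum_mono) simp
  also have "\<dots> = 2 * (\<Sum>i<n. \<bar>l i\<bar>) - 2 * (\<Sum>i<n. l i * ?r i)"
    by (simp add: sum_subtractf sum_distrib_left)
  also have "(\<Sum>i<n. l i * ?r i) = card T"
    using arg_cong[OF trace_Q, of Re] by simp
  finally show ?thesis by simp
qed

section \<open>The case of equality in the trace bound\<close>

context
  assumes tight: "(\<Sum>i<n. \<bar>l i\<bar>) = card T"
begin

text \<open>Equality makes every nonnegative term of \<open>slack\<close> vanish, so
  \<open>w i\<close> is \<open>sgn (l i)\<close> times \<open>Q i\<close> whenever
  \<open>l i\<close> is nonzero; the factor \<open>|l i|\<close> absorbs the case
  \<open>l i = 0\<close>.\<close>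

lemma abs_eigen_Q:
  assumes "i < n" "p < n"
  shows "of_real \<bar>l i\<bar> * w i p = of_real (l i) * Q i p"
proof -
  let ?t = "\<lambda>i. \<bar>l i\<bar> * (\<Sum>p<n. (cmod (w i p - of_real (sgn (l i)) * Q i p))\<^sup>2)"
  have nn: "0 \<le> ?t i" for i by (intro mult_nonneg_nonneg sum_nonneg) auto
  have "(\<Sum>i<n. ?t i) = 0"
    using slack tight nn sum_nonneg[of "{..<n}" ?t] by force
  then have "?t i = 0"
    using nn assms by (subst (asm) sum_nonneg_eq_0_iff) auto
  then have "l i = 0 \<or> w i p = of_real (sgn (l i)) * Q i p"
    using assms by (auto simp: sum_nonneg_eq_0_iff)
  moreover have "complex_of_real \<bar>l i\<bar> * of_real (sgn (l i)) = of_real (l i)"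
    unfolding of_real_mult[symmetric] abs_mult_sgn ..
  ultimately show ?thesis by (metis abs_zero mult.assoc mult_zero_left of_real_0)
qed

text \<open>\<open>S\<close> is the modulus of \<open>A\<close>, written as the Gram matrix of the vectors \<open>(g i p)\<^sub>i\<close>. In the case
  of equality the contraction acts as the sign of \<open>A\<close> on the range of \<open>A\<close>, so its product with
  \<open>A\<close> is \<open>S\<close>.\<close>

definition g :: "nat \<Rightarrow> nat \<Rightarrow> complex" where
  "g i p = of_real (sqrt \<bar>l i\<bar>) * w i p"

definition S :: "nat \<Rightarrow> nat \<Rightarrow> complex" where
  "S p q = (\<Sum>i<n. g i p * cnj (g i q))"

text \<open>Replacing \<open>|l i| w i\<close> by \<open>l i Q i\<close> turns the Gram sum into an
  entry of the product of the matching part of \<open>A\<close> with \<open>A\<close>.\<close>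

lemma S_eq:
  assumes p: "p < n" and q: "q < n"
  shows "S p q = (if p \<in> T then A $$ (p, s p) * A $$ (s p, q) else 0)"
proof -
  have "S p q = (\<Sum>i<n. of_real \<bar>l i\<bar> * w i p * cnj (w i q))"
    unfolding S_def g_def
  proof (intro sum.cong refl)
    fix i
    have "complex_of_real \<bar>l i\<bar> = of_real (sqrt \<bar>l i\<bar>) * of_real (sqrt \<bar>l i\<bar>)"
      unfolding of_real_mult[symmetric] by simp
    then show "of_real (sqrt \<bar>l i\<bar>) * w i p * cnj (of_real (sqrt \<bar>l i\<bar>) * w i q) =
        of_real \<bar>l i\<bar> * w i p * cnj (w i q)"
      by (simp add: mult_ac)
  qed
  also have "\<dots> = (\<Sum>i<n. of_real (l i) * Q i p * cnj (w i q))"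
    using p by (simp add: abs_eigen_Q)
  also have "\<dots> = (if p \<in> T then A $$ (p, s p) * A $$ (s p, q) else 0)"
  proof (cases "p \<in> T")
    case True
    then have "s p < n" using T_sub s_in by blast
    then show ?thesis using True q
      by (subst (2) expand) (simp_all add: Q_def sum_distrib_left mult_ac)
  qed (simp add: Q_def)
  finally show ?thesis .
qed

lemma S_cnj: "cnj (S p q) = S q p"
  by (simp add: S_def mult.commute)

lemma S_diag: assumes "p \<in> T" shows "S p p = 1"
proof -
  have pn: "p < n" "s p < n" using T_sub s_in assms by blast+
  have "S p p = of_real ((cmod (A $$ (p, s p)))\<^sup>2)"
    using assms pn hermitian[OF pn] by (simp only: S_eq complex_norm_square if_True)
  then show ?thesis using unit[OF assms] by simp
qed

text \<open>The Gram vectors of \<open>p\<close> and \<open>q\<close> are unit vectors whose inner product has modulus 1, so they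
  are parallel.\<close>

lemma S_trans:
  assumes p: "p \<in> T" and q: "q \<in> T" and pq: "cmod (S p q) = 1"
  shows "S p r = S p q * S q r"
proof -
  \<comment> \<open>The expansion is done for a free \<open>z\<close> and then specialised to
    \<open>z = S p q\<close>, where the squared distance becomes
    \<open>1 - |S p q|^2 = 0\<close>.\<close>
  have "(\<Sum>i<n. (g i p - z * g i q) * cnj (g i p - z * g i q)) =
      S p p - cnj z * S p q - z * S q p + z * cnj z * S q q" for z
    by (simp add: S_def algebra_simps sum.distrib sum_subtractf sum_distrib_left)
  then have "(\<Sum>i<n. (g i p - S p q * g i q) * cnj (g i p - S p q * g i q)) =
      S p p - cnj (S p q) * S p q - S p q * S q p + S p q * cnj (S p q) * S q q" .
  also have "\<dots> = 1 - S p q * cnj (S p q)"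
    by (simp add: S_diag p q S_cnj mult.commute)
  also have "\<dots> = 0" using pq by (simp flip: complex_norm_square)
  finally have "of_real (\<Sum>i<n. (cmod (g i p - S p q * g i q))\<^sup>2) = (0 :: complex)"
    by (simp add: complex_norm_square del: of_real_power)
  then have "(\<Sum>i<n. (cmod (g i p - S p q * g i q))\<^sup>2) = 0" using of_real_eq_0_iff by blast
  then have "g i p = S p q * g i q" if "i < n" for i
    using that by (simp add: sum_nonneg_eq_0_iff)
  then have "S p r = (\<Sum>i<n. S p q * g i q * cnj (g i r))"
    unfolding S_def[of p r] by (intro sum.cong) auto
  then show ?thesis by (simp add: S_def[of q r] sum_distrib_left mult_ac)
qed

text \<open>\<open>Q i\<close> vanishes off \<open>T\<close>, so \<open>abs_eigen_Q\<close> kills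
  every term of the spectral expansion of row \<open>p\<close>.\<close>

lemma zero_row: assumes p: "p < n" "p \<notin> T" and q: "q < n" shows "A $$ (p, q) = 0"
proof -
  have "of_real (l i) * w i p = 0" if "i < n" for i
    using abs_eigen_Q[OF that p(1)] p(2) by (auto simp: Q_def)
  then show ?thesis using p q by (subst expand) (auto intro!: sum.neutral)
qed

end

end

section \<open>Gain graphs\<close>

lemma mult_cnj_unit: "cmod z = 1 \<Longrightarrow> z * cnj z = 1"
  by (simp flip: complex_norm_square)

lemma cnj_mult_unit: "cmod z = 1 \<Longrightarrow> cnj z * z = 1"
  using mult_cnj_unit by (simp add: mult.commute)

text \<open>Entrywise form of switching: a diagonal \<open>U\<close> collapses both matrix products
  to single terms. Applied to the identity matrix, it also computes
  \<open>U * mat_adjoint U\<close>.\<close>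

lemma conjugate_diagonal_index:
  fixes U A :: "complex mat"
  assumes U: "U \<in> carrier_mat n n" "diagonal_mat U" and A: "A \<in> carrier_mat n n"
    and ij: "i < n" "j < n"
  shows "(U * A * mat_adjoint U) $$ (i, j) = U $$ (i, i) * A $$ (i, j) * cnj (U $$ (j, j))"
proof -
  have U0: "U $$ (i, j) = 0" if "i < n" "j < n" "i \<noteq> j" for i j
    using U that by (auto simp: diagonal_mat_def)
  have UA: "(U * A) $$ (i, k) = U $$ (i, i) * A $$ (i, k)" if "k < n" for k
  proof -
    have "(U * A) $$ (i, k) = (\<Sum>x<n. U $$ (i, x) * A $$ (x, k))"
      using U A ij that by (simp add: scalar_prod_def atLeast0LessThan)
    also have "\<dots> = (\<Sum>x<n. if x = i then U $$ (i, i) * A $$ (i, k) else 0)"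
      using ij by (intro sum.cong) (auto simp: U0)
    finally show ?thesis using ij by simp
  qed
  have "(U * A * mat_adjoint U) $$ (i, j) = (\<Sum>k<n. (U * A) $$ (i, k) * cnj (U $$ (j, k)))"
    using U A ij by (simp add: scalar_prod_def atLeast0LessThan)
  also have "\<dots> = (\<Sum>k<n. if k = j then U $$ (i, i) * A $$ (i, j) * cnj (U $$ (j, j)) else 0)"
    using ij by (intro sum.cong) (auto simp: U0 UA)
  finally show ?thesis using ij by simp
qed

lemma unitary_diagonal_cmod:
  assumes U: "U \<in> carrier_mat n n" "diagonal_mat U" "unitary_mat U" and i: "i < n"
  shows "cmod (U $$ (i, i)) = 1"
proof -
  have "(U * 1\<^sub>m n * mat_adjoint U) $$ (i, i) = 1"
    using U i by (simp add: unitary_mat_def)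
  then have "U $$ (i, i) * cnj (U $$ (i, i)) = 1"
    using conjugate_diagonal_index[OF U(1,2) one_carrier_mat i i] i by simp
  then have "of_real ((cmod (U $$ (i, i)))\<^sup>2) = (1 :: complex)" by (simp only: complex_norm_square)
  then have "(cmod (U $$ (i, i)))\<^sup>2 = 1" by (simp only: of_real_eq_1_iff)
  then show ?thesis using norm_ge_zero[of "U $$ (i, i)"] by (simp add: power2_eq_1_iff)
qed

text \<open>Symmetry of the arcs upgrades connectedness to strong connectedness, so membership in
  \<open>K\<close> propagates along a directed walk from \<open>u\<close>.\<close>

lemma connected_closed_superset:
  assumes G: "pair_graph G" and conn: "Digraph_Component.connected (with_proj G)"
    and u: "u \<in> pverts G" "u \<in> K"
    and closed: "\<And>x y. x \<in> K \<Longrightarrow> (x, y) \<in> parcs G \<Longrightarrow> y \<in> K"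
  shows "pverts G \<subseteq> K"
proof
  interpret pair_graph G by (rule G)
  fix v assume v: "v \<in> pverts G"
  have "strongly_connected (with_proj G)"
    by (rule symmetric_connected_imp_strongly_connected[OF sym_arcs conn])
  then have "reachable (with_proj G) u v" using u v by (auto simp: strongly_connected_def)
  then have "(u, v) \<in> rtrancl_on (pverts G) (parcs G)" by (simp add: reachable_def)
  then show "v \<in> K" by (induction rule: rtrancl_on_induct) (use u closed in auto)
qed

locale T_gain =
  fixes n :: nat and G :: "nat pair_pre_digraph" and \<phi> :: "nat \<times> nat \<Rightarrow> complex"
  assumes gain: "T_gain_graph n (G, \<phi>)"
begin

abbreviation "A \<equiv> adjacency_matrix (G, \<phi>)"

lemma pair_graph_G: "pair_graph G" and verts_G: "pverts G = {0..<n}"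
  using gain by (auto simp: T_gain_graph_def)

lemma A_carrier: "A \<in> carrier_mat n n"
  by (simp add: adjacency_matrix_def verts_G)

lemma arc_less: "(p, q) \<in> parcs G \<Longrightarrow> p < n \<and> q < n"
proof -
  interpret pair_graph G by (rule pair_graph_G)
  assume "(p, q) \<in> parcs G"
  then show "p < n \<and> q < n" using arc_fst_in_verts arc_snd_in_verts verts_G by fastforce
qed

lemma arc_sym: "(p, q) \<in> parcs G \<Longrightarrow> (q, p) \<in> parcs G"
proof -
  interpret pair_graph G by (rule pair_graph_G)
  show "(p, q) \<in> parcs G \<Longrightarrow> (q, p) \<in> parcs G" by (rule arcs_symmetric)
qed

lemma arc_irrefl: "(p, p) \<notin> parcs G"
proof -
  interpret pair_graph G by (rule pair_graph_G)
  show ?thesis using no_loops' by blast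
qed

lemma A_index: "p < n \<Longrightarrow> q < n \<Longrightarrow> A $$ (p, q) = (if (p, q) \<in> parcs G then \<phi> (p, q) else 0)"
  by (simp add: adjacency_matrix_def verts_G)

lemma cmod_A: "(p, q) \<in> parcs G \<Longrightarrow> cmod (A $$ (p, q)) = 1"
  using gain arc_less by (auto simp: A_index T_gain_graph_def)

lemma A_nonzero: "p < n \<Longrightarrow> q < n \<Longrightarrow> A $$ (p, q) \<noteq> 0 \<longleftrightarrow> (p, q) \<in> parcs G"
  using cmod_A[of p q] by (auto simp: A_index)

lemma A_adjoint: "mat_adjoint A = A"
proof (intro eq_matI)
  fix p q assume "p < dim_row A" "q < dim_col A"
  then have pq: "p < n" "q < n" using A_carrier by auto
  have "cnj (\<phi> (q, p)) = \<phi> (p, q)" if "(q, p) \<in> parcs G"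
  proof -
    have "cmod (\<phi> (q, p)) = 1" and "\<phi> (p, q) = inverse (\<phi> (q, p))"
      using gain that by (auto simp: T_gain_graph_def)
    then show ?thesis by (simp add: inverse_complex_def complex_norm_square complex_eq_iff cmod_def)
  qed
  then show "mat_adjoint A $$ (p, q) = A $$ (p, q)"
    using pq A_carrier arc_sym by (auto simp: A_index)
qed (use A_carrier in auto)

lemma energy_eigensystem:
  obtains w l where "eigensystem n A w l" "energy (G, \<phi>) = (\<Sum>i<n. \<bar>l i\<bar>)"
  using hermitian_eigensystem[OF A_carrier A_adjoint] by (auto simp: energy_def Let_def)

section \<open>Matchings as involutions\<close>

lemma finite_uedges: "finite (uedges G)"
proof -
  have "uedges G = (\<lambda>(u, v). {u, v}) ` parcs G" by (auto simp: uedges_def)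
  moreover from arc_less have "parcs G \<subseteq> {..<n} \<times> {..<n}" by auto
  then have "finite (parcs G)" by (rule finite_subset) simp
  ultimately show ?thesis by simp
qed

lemma finite_matchings: "finite {M. matching G M}"
  using finite_uedges by (auto simp: matching_def intro: finite_subset[of _ "Pow (uedges G)"])

lemma card_matching_le: "matching G M \<Longrightarrow> card M \<le> matching_number G"
  unfolding matching_number_def using finite_matchings by (intro Max_ge) auto

lemma obtain_maximum_matching:
  obtains M where "matching G M" "card M = matching_number G"
proof -
  have "matching G {}" by (simp add: matching_def disjoint_def)
  then have "matching_number G \<in> card ` {M. matching G M}"
    unfolding matching_number_def using finite_matchings by (intro Max_in) auto
  then show thesis using that by auto
qed

text \<open>Disjointness gives each covered vertex a unique partner, so a set of edges becomes an
  involution \<open>s\<close> of the kind required by \<open>eigensystem_matching\<close>.\<close>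

lemma matching_involution:
  assumes M: "matching G M"
  obtains s where "\<Union>M \<subseteq> {..<n}" "\<And>p. p \<in> \<Union>M \<Longrightarrow> s p \<in> \<Union>M" "\<And>p. p \<in> \<Union>M \<Longrightarrow> s (s p) = p"
    "\<And>p. p \<in> \<Union>M \<Longrightarrow> (p, s p) \<in> parcs G" "card (\<Union>M) = 2 * card M"
proof -
  have edge: "\<exists>u v. e = {u, v} \<and> (u, v) \<in> parcs G" if "e \<in> M" for e
    using M that by (auto simp: matching_def uedges_def)
  have arc: "(p, q) \<in> parcs G" if "{p, q} \<in> M" for p q
    using edge[OF that] arc_sym by (auto simp: doubleton_eq_iff)
  have uniq: "q = q'" if "{p, q} \<in> M" "{p, q'} \<in> M" for p q q'
  proof -
    have "{p, q} = {p, q'}"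
      using disjointD[of M "{p, q}" "{p, q'}"] that M by (auto simp: matching_def)
    then show ?thesis by (auto simp: doubleton_eq_iff)
  qed
  define s where "s p = (THE q. {p, q} \<in> M)" for p
  have s: "{p, s p} \<in> M" if "p \<in> \<Union>M" for p
  proof -
    from that obtain e where e: "e \<in> M" "p \<in> e" by blast
    with edge obtain u v where "e = {u, v}" by blast
    \<comment> \<open>The conditional picks the endpoint of \<open>e\<close> other than
      \<open>p\<close>.\<close>
    then have "{p, if p = u then v else u} = e" using e(2) by auto
    then have f: "{p, if p = u then v else u} \<in> M" using e(1) by simp
    show ?thesis unfolding s_def by (rule theI[of "\<lambda>q. {p, q} \<in> M", OF f]) (rule uniq[OF _ f])
  qed
  have s_eq: "s p = q" if "{p, q} \<in> M" for p q
    using s[of p] uniq that by blast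
  show thesis
  proof (rule that[of s])
    show "\<Union>M \<subseteq> {..<n}" using edge arc_less by fastforce
    have "card (\<Union>M) = (\<Sum>e\<in>M. card e)"
    proof (rule card_Union_disjoint)
      show "pairwise disjnt M"
        using M by (auto simp: matching_def disjoint_def pairwise_def disjnt_def)
      show "finite e" if "e \<in> M" for e using edge[OF that] by auto
    qed
    also have "\<dots> = (\<Sum>e\<in>M. 2)"
    proof (intro sum.cong refl)
      fix e assume "e \<in> M"
      then obtain u v where "e = {u, v}" "(u, v) \<in> parcs G" using edge by blast
      moreover from this have "u \<noteq> v" using arc_irrefl by metis
      ultimately show "card e = 2" by simp
    qed
    finally show "card (\<Union>M) = 2 * card M" by simp
    fix p assume p: "p \<in> \<Union>M"
    show "(p, s p) \<in> parcs G" using arc s[OF p] .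
    show "s p \<in> \<Union>M" using s[OF p] by auto
    show "s (s p) = p" using s[OF p] by (intro s_eq) (simp add: insert_commute)
  qed
qed

lemma twice_matching_number_le: "2 * matching_number G \<le> n"
proof -
  obtain M where M: "matching G M" "card M = matching_number G" by (rule obtain_maximum_matching)
  obtain s where "\<Union>M \<subseteq> {..<n}" "card (\<Union>M) = 2 * card M" using matching_involution[OF M(1)] by metis
  then show ?thesis using M(2) card_mono[of "{..<n}" "\<Union>M"] by simp
qed

section \<open>Switching to gains 1\<close>

lemma switching_unit_gainI:
  assumes u: "\<And>p. p < n \<Longrightarrow> cmod (u p) = 1"
    and uA: "\<And>p q. (p, q) \<in> parcs G \<Longrightarrow> u p * A $$ (p, q) * cnj (u q) = 1"
  shows "(G, \<phi>) \<sim>\<^sub>s unit_gain G"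
proof -
  define U where "U = mat n n (\<lambda>(i, j). if i = j then u i else 0)"
  have U: "U \<in> carrier_mat n n" and diag: "diagonal_mat U" by (auto simp: U_def diagonal_mat_def)
  have U': "mat_adjoint U \<in> carrier_mat n n" using U by simp
  have Uii: "U $$ (i, i) = u i" if "i < n" for i using that by (simp add: U_def)
  have "U * mat_adjoint U = 1\<^sub>m n"
  proof (intro eq_matI)
    fix i j assume "i < dim_row (1\<^sub>m n :: complex mat)" "j < dim_col (1\<^sub>m n :: complex mat)"
    then have ij: "i < n" "j < n" by auto
    have "u i * cnj (u i) = 1" using u[OF ij(1)] by (rule mult_cnj_unit)
    then show "(U * mat_adjoint U) $$ (i, j) = 1\<^sub>m n $$ (i, j)"
      using conjugate_diagonal_index[OF U diag one_carrier_mat ij] U ij by (auto simp: Uii)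
  qed (use U in auto)
  moreover from this have "mat_adjoint U * U = 1\<^sub>m n"
    by (rule mat_mult_left_right_inverse[OF U U'])
  ultimately have "unitary_mat U" using U by (auto simp: unitary_mat_def)
  moreover have "adjacency_matrix (unit_gain G) = U * A * mat_adjoint U"
  proof (intro eq_matI)
    fix i j assume "i < dim_row (U * A * mat_adjoint U)" "j < dim_col (U * A * mat_adjoint U)"
    then have ij: "i < n" "j < n" using U by auto
    show "adjacency_matrix (unit_gain G) $$ (i, j) = (U * A * mat_adjoint U) $$ (i, j)"
      using ij uA[of i j] unfolding conjugate_diagonal_index[OF U diag A_carrier ij]
      by (auto simp: adjacency_matrix_def unit_gain_def verts_G Uii)
  qed (use U in \<open>auto simp: adjacency_matrix_def unit_gain_def verts_G\<close>)
  ultimately show ?thesis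
    unfolding switching_equivalent_def using U diag A_carrier by auto
qed

text \<open>Switching multiplies entries by numbers of modulus 1 and so preserves the zero pattern,
  which forces the arcs of \<open>H\<close> to be those of \<open>G\<close>; \<open>u\<close> is the
  diagonal of the switching matrix.\<close>

lemma switching_unit_gainD:
  assumes sw: "(G, \<phi>) \<sim>\<^sub>s unit_gain H" and H: "pverts H = {0..<n}" "parcs H \<subseteq> {0..<n} \<times> {0..<n}"
  obtains u where "\<And>p. p < n \<Longrightarrow> cmod (u p) = 1" "parcs H = parcs G"
    "\<And>p q. (p, q) \<in> parcs G \<Longrightarrow> u p * A $$ (p, q) * cnj (u q) = 1"
proof -
  obtain U where U: "U \<in> carrier_mat n n" "diagonal_mat U" "unitary_mat U"
    and eq: "adjacency_matrix (unit_gain H) = U * A * mat_adjoint U"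
    using sw A_carrier by (auto simp: switching_equivalent_def)
  define u where "u p = U $$ (p, p)" for p
  have u: "cmod (u p) = 1" if "p < n" for p
    unfolding u_def by (rule unitary_diagonal_cmod[OF U that])
  have ind: "(if (p, q) \<in> parcs H then 1 else 0) = u p * A $$ (p, q) * cnj (u q)" if "p < n" "q < n" for p q
  proof -
    have "adjacency_matrix (unit_gain H) $$ (p, q) = (if (p, q) \<in> parcs H then 1 else 0)"
      using that by (simp add: adjacency_matrix_def unit_gain_def H(1))
    then show ?thesis unfolding eq conjugate_diagonal_index[OF U(1,2) A_carrier that] u_def by simp
  qed
  have "(p, q) \<in> parcs H \<longleftrightarrow> (p, q) \<in> parcs G" if "p < n" "q < n" for p q
  proof -
    have "u p \<noteq> 0" "u q \<noteq> 0" using u that by force+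
    then show ?thesis using ind[OF that] A_nonzero[OF that] by (auto split: if_splits)
  qed
  then have "parcs H = parcs G" using H(2) arc_less by auto
  then show thesis using that[of u] u ind arc_less by metis
qed

section \<open>From equality to a balanced complete bipartite graph\<close>

lemma equality_imp_complete_bipartite:
  assumes conn: "Digraph_Component.connected (with_proj G)"
    and X: "{0..<n} = X \<union> Y" "X \<inter> Y = {}" "parcs G \<subseteq> X \<times> Y \<union> Y \<times> X"
    and p0: "p0 \<in> X" and n: "n \<ge> 2"
    and eq: "energy (G, \<phi>) = 2 * real (matching_number G)"
  shows "card X = card Y \<and> parcs G = X \<times> Y \<union> Y \<times> X \<and> (G, \<phi>) \<sim>\<^sub>s unit_gain G"
proof -
  obtain w l where e: "eigensystem n A w l" "energy (G, \<phi>) = (\<Sum>i<n. \<bar>l i\<bar>)"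
    by (rule energy_eigensystem)
  obtain M where M: "matching G M" "card M = matching_number G" by (rule obtain_maximum_matching)
  obtain s where s: "\<Union>M \<subseteq> {..<n}" "\<And>p. p \<in> \<Union>M \<Longrightarrow> s p \<in> \<Union>M" "\<And>p. p \<in> \<Union>M \<Longrightarrow> s (s p) = p"
    "\<And>p. p \<in> \<Union>M \<Longrightarrow> (p, s p) \<in> parcs G" "card (\<Union>M) = 2 * card M"
    using matching_involution[OF M(1)] by metis
  interpret E: eigensystem n A w l by (rule e)
  interpret E: eigensystem_matching n A w l "\<Union>M" s
    by unfold_locales (use s cmod_A in blast)+
  have tight: "(\<Sum>i<n. \<bar>l i\<bar>) = card (\<Union>M)" using eq by (simp add: s(5) M(2) e(2))
  note closed = connected_closed_superset[OF pair_graph_G conn, unfolded verts_G]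
  \<comment> \<open>For an isolated \<open>p\<close> the set \<open>{p}\<close> would be closed
    under adjacency and hence contain all \<open>n \<ge> 2\<close> vertices.\<close>
  have "\<exists>q. (p, q) \<in> parcs G" if "p < n" for p
  proof (rule ccontr)
    assume "\<not> ?thesis"
    then have "{0..<n} \<subseteq> {p}" using that by (intro closed[of p]) auto
    then have "n \<le> card {p}" using card_mono[of "{p}" "{0..<n}"] by simp
    then show False using n by simp
  qed
  then have perfect: "\<Union>M = {..<n}"
    using E.zero_row[OF tight] A_nonzero arc_less s(1) by blast
  note s = s(2-4)[unfolded perfect lessThan_iff]
  have S: "E.S p q = A $$ (p, s p) * A $$ (s p, q)" if "p < n" "q < n" for p q
    using E.S_eq[OF tight that] that by (simp add: perfect)
  \<comment> \<open>The support of \<open>S\<close> relates \<open>p\<close> to \<open>q\<close>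
    when the partner of \<open>p\<close> is adjacent to \<open>q\<close>; \<open>trans\<close> and
    \<open>S_sym\<close> below give transitivity and symmetry.\<close>
  have S_nz: "E.S p q \<noteq> 0 \<longleftrightarrow> (s p, q) \<in> parcs G" if "p < n" "q < n" for p q
    using S[OF that] A_nonzero[of p "s p"] A_nonzero[of "s p" q] that s by auto
  have cmod_S: "cmod (E.S p q) = 1" if "p < n" "q < n" "(s p, q) \<in> parcs G" for p q
    using that S[OF that(1,2)] s(3)[OF that(1)] by (simp add: norm_mult cmod_A)
  have trans: "E.S p r = E.S p q * E.S q r" if "p < n" "q < n" "E.S p q \<noteq> 0" for p q r
  proof (rule E.S_trans[OF tight])
    show "cmod (E.S p q) = 1" using that by (intro cmod_S) (simp_all add: S_nz)
  qed (use that in \<open>simp_all add: perfect\<close>)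
  have p0n: "p0 < n" using p0 X(1) by auto
  have S_sym: "E.S q p \<noteq> 0" if "E.S p q \<noteq> 0" for p q
    using that E.S_cnj[OF tight, of p q] by (metis complex_cnj_zero_iff)
  \<comment> \<open>The class of \<open>p0\<close> under the support relation; it will turn out to
    be \<open>X\<close>.\<close>
  define C where "C = {x. x < n \<and> E.S p0 x \<noteq> 0}"
  \<comment> \<open>\<open>y\<close> is the partner of \<open>s y\<close> and is adjacent to
    \<open>x\<close>, so \<open>s y\<close> is related to \<open>x\<close>.\<close>
  have C_step: "s y \<in> C" if "x \<in> C" "(x, y) \<in> parcs G" for x y
  proof -
    have "x < n" "y < n" "s y < n" using that arc_less s by (auto simp: C_def)
    moreover have "E.S (s y) x \<noteq> 0"
      using calculation that s arc_sym by (simp add: S_nz)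
    ultimately show ?thesis
      using trans[of p0 x "s y"] S_sym p0n that by (auto simp: C_def)
  qed
  have C_step': "y \<in> C" if "x < n" "s x \<in> C" "(x, y) \<in> parcs G" for x y
  proof -
    have "y < n" "s x < n" using that arc_less s by auto
    moreover have "E.S (s x) y \<noteq> 0"
      using calculation that s by (simp add: S_nz)
    ultimately show ?thesis
      using trans[of p0 "s x" y] p0n that by (auto simp: C_def)
  qed
  have "p0 \<in> C" using p0n s arc_sym by (auto simp: C_def S_nz)
  then have cover: "{0..<n} \<subseteq> C \<union> {x. x < n \<and> s x \<in> C}"
  proof (intro closed[of p0])
    fix x y assume x: "x \<in> C \<union> {x. x < n \<and> s x \<in> C}" and xy: "(x, y) \<in> parcs G"
    show "y \<in> C \<union> {x. x < n \<and> s x \<in> C}"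
      using x C_step[OF _ xy] C_step'[OF _ _ xy] arc_less[OF xy] by blast
  qed (use p0n in simp_all)
  have side: "(x \<in> X \<longleftrightarrow> y \<in> Y) \<and> (x \<in> Y \<longleftrightarrow> y \<in> X)" if "(x, y) \<in> parcs G" for x y
    using that X by blast
  \<comment> \<open>A member \<open>x\<close> of \<open>C\<close> is reached from \<open>p0\<close>
    by the walk \<open>p0\<close>, \<open>s p0\<close>, \<open>x\<close> of length two, so it stays
    on the side of \<open>p0\<close>.\<close>
  have "C \<subseteq> X" using side[OF s(3)[OF p0n]] side p0 p0n by (auto simp: C_def S_nz)
  moreover have "x \<in> Y" if "x < n" "s x \<in> C" for x
    using that calculation side[OF s(3)] by auto
  ultimately have "X \<subseteq> C" "\<forall>y\<in>Y. s y \<in> C" using cover X(1,2) by blast+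
  then have XC: "x \<in> X \<Longrightarrow> x \<in> C" and YC: "y \<in> Y \<Longrightarrow> s y \<in> C" for x y by auto
  have Xn: "x < n" if "x \<in> X" for x using that X by auto
  have Yn: "y < n" if "y \<in> Y" for y using that X by auto
  have bij: "bij_betw s X Y"
  proof (rule bij_betw_byWitness[of _ s])
    show "s ` X \<subseteq> Y" "s ` Y \<subseteq> X" using side[OF s(3)] Xn Yn by blast+
  qed (use s(2) Xn Yn in simp_all)
  \<comment> \<open>Both \<open>s y\<close> and \<open>x\<close> lie in the class of
    \<open>p0\<close>, hence are related through \<open>p0\<close>. As \<open>s (s y) = y\<close>,
    this says that \<open>y\<close> and \<open>x\<close> are adjacent.\<close>
  have S_yx: "E.S (s y) x = E.S (s y) p0 * E.S p0 x" "E.S (s y) x \<noteq> 0" if "x \<in> X" "y \<in> Y" for x y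
  proof -
    have "E.S (s y) p0 \<noteq> 0" using YC[OF that(2)] S_sym by (auto simp: C_def)
    then show "E.S (s y) x = E.S (s y) p0 * E.S p0 x"
      using trans that Yn p0n s by blast
    then show "E.S (s y) x \<noteq> 0"
      using XC[OF that(1)] \<open>E.S (s y) p0 \<noteq> 0\<close> by (simp add: C_def)
  qed
  have arc: "(y, x) \<in> parcs G" if "x \<in> X" "y \<in> Y" for x y
    using S_yx(2)[OF that] S_nz[of "s y" x] s Xn Yn that by auto
  then have arcs: "parcs G = X \<times> Y \<union> Y \<times> X" using X(3) arc_sym by blast
  \<comment> \<open>The choice comes from the factorisation
    \<open>A $$ (y, x) = A $$ (y, p0) * S p0 x\<close> derived below: \<open>u y\<close> cancels the
    first factor and \<open>cnj (u x)\<close> the second.\<close>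
  define u where "u p = (if p \<in> X then E.S p0 p else A $$ (p0, p))" for p
  have cmod_u: "cmod (u p) = 1" if "p < n" for p
  proof (cases "p \<in> X")
    case True
    then show ?thesis using XC p0n that cmod_S[of p0 p] S_nz[of p0 p] by (simp add: u_def C_def)
  next
    case False
    then have "p \<in> Y" using that X by auto
    then show ?thesis using False arc[OF p0] arc_sym cmod_A by (simp add: u_def)
  qed
  have uyx: "u y * A $$ (y, x) * cnj (u x) = 1" if x: "x \<in> X" and y: "y \<in> Y" for x y
  proof -
    have n: "x < n" "y < n" "s y < n" using x y Xn Yn s by auto
    have yX: "y \<notin> X" using y X by auto
    have a: "A $$ (s y, y) * A $$ (y, x) = A $$ (s y, y) * A $$ (y, p0) * E.S p0 x"
      using S_yx(1)[OF x y] n s p0n by (simp add: S)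
    have "A $$ (s y, y) \<noteq> 0" using s[of y] n arc_sym by (simp add: A_nonzero)
    with a have "A $$ (y, x) = A $$ (y, p0) * E.S p0 x" by simp
    moreover have "cmod (E.S p0 x) = 1" using cmod_u[of x] n x by (simp add: u_def)
    moreover have "A $$ (p0, y) = cnj (A $$ (y, p0))" using E.hermitian n p0n by simp
    moreover have "cmod (A $$ (y, p0)) = 1" using arc[OF p0 y] by (rule cmod_A)
    ultimately have "u y * A $$ (y, x) * cnj (u x) = (cnj (A $$ (y, p0)) * A $$ (y, p0)) * (E.S p0 x * cnj (E.S p0 x))"
      and "cnj (A $$ (y, p0)) * A $$ (y, p0) = 1" "E.S p0 x * cnj (E.S p0 x) = 1"
      using x yX cnj_mult_unit mult_cnj_unit by (simp_all add: u_def mult_ac)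
    then show ?thesis by simp
  qed
  have "u p * A $$ (p, q) * cnj (u q) = 1" if pq: "(p, q) \<in> parcs G" for p q
  proof (cases "p \<in> Y")
    case True
    then show ?thesis using pq uyx side by blast
  next
    case False
    then have "p \<in> X" "q \<in> Y" using pq arcs by auto
    \<comment> \<open>Arcs from \<open>X\<close> to \<open>Y\<close> are the conjugates of those
      treated in \<open>uyx\<close>.\<close>
    then have "cnj (u q * A $$ (q, p) * cnj (u p)) = 1" by (simp add: uyx)
    then show ?thesis using E.hermitian[of q p] arc_less[OF pq] by (simp add: mult_ac)
  qed
  then show ?thesis
    using bij_betw_same_card[OF bij] arcs cmod_u switching_unit_gainI[of u] by blast
qed

section \<open>Energy and matching number of the balanced complete bipartite graph\<close>

text \<open>All eigenvalues are \<open>0\<close> or \<open>\<plusminus>m\<close>, so the energy is the sum of the squared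
  eigenvalues divided by \<open>m\<close>, that is, the squared Frobenius norm divided by \<open>m\<close>.\<close>

lemma energy_of_switched_complete_bipartite:
  assumes X: "{0..<n} = X \<union> Y" "X \<inter> Y = {}" "card X = m" "card Y = m" "m > 0"
    and arcs: "parcs G = X \<times> Y \<union> Y \<times> X"
    and u: "\<And>p. p < n \<Longrightarrow> cmod (u p) = 1"
    and uA: "\<And>p q. (p, q) \<in> parcs G \<Longrightarrow> u p * A $$ (p, q) * cnj (u q) = 1"
  shows "energy (G, \<phi>) = 2 * real m"
proof -
  obtain w l where e: "eigensystem n A w l" "energy (G, \<phi>) = (\<Sum>i<n. \<bar>l i\<bar>)"
    by (rule energy_eigensystem)
  interpret E: eigensystem n A w l by (rule e)
  have fin: "finite X" "finite Y" by (metis X(1) finite_Un finite_atLeastLessThan)+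
  have Xn: "X \<subseteq> {..<n}" "Y \<subseteq> {..<n}" using X(1) by auto
  have abs_l: "\<bar>l i\<bar> = (l i)\<^sup>2 / m" if i: "i < n" for i
  proof -
    \<comment> \<open>Switching by \<open>u\<close> turns \<open>A\<close> into the 0-1 adjacency
      matrix, and \<open>f\<close> is the switched eigenvector for \<open>l i\<close>.\<close>
    define f where "f p = u p * w i p" for p
    note cc = cnj_mult_unit[OF u]
    have row: "(\<Sum>q<n. if (p, q) \<in> parcs G then f q else 0) = of_real (l i) * f p" if p: "p < n" for p
    proof -
      have "(\<Sum>q<n. if (p, q) \<in> parcs G then f q else 0) = (\<Sum>q<n. u p * (A $$ (p, q) * w i q))"
      proof (intro sum.cong refl)
        fix q assume "q \<in> {..<n}"
        then have q: "q < n" by simp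
        have "u p * A $$ (p, q) * cnj (u q) * f q = u p * (A $$ (p, q) * w i q) * (cnj (u q) * u q)"
          by (simp add: f_def mult_ac)
        then have step: "u p * A $$ (p, q) * cnj (u q) * f q = u p * (A $$ (p, q) * w i q)"
          by (simp only: cc[OF q] mult_1_right)
        show "(if (p, q) \<in> parcs G then f q else 0) = u p * (A $$ (p, q) * w i q)"
        proof (cases "(p, q) \<in> parcs G")
          case True
          then show ?thesis using step unfolding uA[OF True] by (simp only: if_True mult_1_left)
        qed (simp add: A_index p q)
      qed
      then show ?thesis
        using E.eigen[OF i p] by (simp add: f_def mult_ac flip: sum_distrib_left)
    qed
    have rX: "sum f Y = of_real (l i) * f p" if "p \<in> X" for p
    proof -
      have "(\<Sum>q<n. if (p, q) \<in> parcs G then f q else 0) = sum f Y"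
        using that X(2) Xn by (intro sum.mono_neutral_cong_right) (auto simp: arcs)
      then show ?thesis using row that Xn by auto
    qed
    have rY: "sum f X = of_real (l i) * f p" if "p \<in> Y" for p
    proof -
      have "(\<Sum>q<n. if (p, q) \<in> parcs G then f q else 0) = sum f X"
        using that X(2) Xn by (intro sum.mono_neutral_cong_right) (auto simp: arcs)
      then show ?thesis using row that Xn by auto
    qed
    \<comment> \<open>Summing the eigenvalue equations over one side links the two side sums of
      \<open>f\<close>; together with \<open>s2\<close> this is a 2 by 2 system.\<close>
    have s1: "of_nat m * sum f Y = of_real (l i) * sum f X"
    proof -
      have "of_nat m * sum f Y = (\<Sum>p\<in>X. sum f Y)" by (simp add: X(3))
      also have "\<dots> = (\<Sum>p\<in>X. of_real (l i) * f p)" using rX by (rule sum.cong[OF refl])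
      finally show ?thesis by (simp only: sum_distrib_left)
    qed
    have s2: "of_nat m * sum f X = of_real (l i) * sum f Y"
    proof -
      have "of_nat m * sum f X = (\<Sum>p\<in>Y. sum f X)" by (simp add: X(4))
      also have "\<dots> = (\<Sum>p\<in>Y. of_real (l i) * f p)" using rY by (rule sum.cong[OF refl])
      finally show ?thesis by (simp only: sum_distrib_left)
    qed
    \<comment> \<open>Unless \<open>(l i)^2 = m^2\<close>, the system forces both side sums to
      vanish; then \<open>l i * f p = 0\<close> for every vertex \<open>p\<close>, while
      \<open>f\<close> is not identically zero.\<close>
    have "l i = 0 \<or> (l i)\<^sup>2 = (real m)\<^sup>2"
    proof (rule disjCI)
      assume ne: "(l i)\<^sup>2 \<noteq> (real m)\<^sup>2"
      have "of_real (l i) * (of_real (l i) * sum f X) = of_nat m * (of_nat m * sum f X)"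
        unfolding s2 s1[symmetric] by (rule mult.left_commute)
      then have "of_real ((l i)\<^sup>2) * sum f X = of_real ((real m)\<^sup>2) * sum f X"
        by (simp add: power2_eq_square mult.assoc)
      moreover have "of_real (l i) * (of_real (l i) * sum f Y) = of_nat m * (of_nat m * sum f Y)"
        unfolding s1 s2[symmetric] by (rule mult.left_commute)
      then have "of_real ((l i)\<^sup>2) * sum f Y = of_real ((real m)\<^sup>2) * sum f Y"
        by (simp add: power2_eq_square mult.assoc)
      ultimately have z: "sum f X = 0" "sum f Y = 0"
        using ne by (auto simp only: mult_cancel_right of_real_eq_iff)
      show "l i = 0"
      proof (rule ccontr)
        assume "l i \<noteq> 0"
        have f0: "f p = 0" if "p < n" for p
        proof -
          have "p \<in> X \<union> Y" using that by (simp flip: X(1))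
          then show ?thesis using rX[of p] rY[of p] z \<open>l i \<noteq> 0\<close> by auto
        qed
        have "w i p = 0" if "p < n" for p using f0[OF that] u[OF that] by (auto simp: f_def)
        then show False using E.norm_w[OF i] by simp
      qed
    qed
    then show ?thesis
    proof
      assume "(l i)\<^sup>2 = (real m)\<^sup>2"
      then have "\<bar>l i\<bar> = m" by (auto simp: power2_eq_iff)
      then show ?thesis using \<open>(l i)\<^sup>2 = (real m)\<^sup>2\<close> X(5) by (simp add: power2_eq_square)
    qed simp
  qed
  have "(cmod (A $$ (p, q)))\<^sup>2 = (if (p, q) \<in> parcs G then 1 else 0)" if "p < n" "q < n" for p q
    using cmod_A[of p q] A_nonzero[OF that] by (cases "(p, q) \<in> parcs G") auto
  then have "(\<Sum>p<n. \<Sum>q<n. (cmod (A $$ (p, q)))\<^sup>2) = (\<Sum>p<n. \<Sum>q<n. if (p, q) \<in> parcs G then 1 else 0)"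
    by (intro sum.cong refl) simp
  also have "\<dots> = (\<Sum>z\<in>{..<n} \<times> {..<n}. if z \<in> parcs G then 1 else 0)"
    by (simp add: sum.cartesian_product)
  also have "\<dots> = (\<Sum>z\<in>parcs G. 1)"
    using Xn by (intro sum.mono_neutral_cong_right) (auto simp: arcs)
  also have "\<dots> = 2 * (real m)\<^sup>2"
  proof -
    have "card (X \<times> Y \<union> Y \<times> X) = card (X \<times> Y) + card (Y \<times> X)"
      using fin X(2) by (intro card_Un_disjoint) auto
    then show ?thesis by (simp add: arcs card_cartesian_product X power2_eq_square)
  qed
  finally have "(\<Sum>i<n. (l i)\<^sup>2) = 2 * (real m)\<^sup>2" by (simp add: E.sum_eigenvalues_sq)
  moreover have "energy (G, \<phi>) = (\<Sum>i<n. (l i)\<^sup>2) / m"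
    unfolding e(2) by (simp add: abs_l sum_divide_distrib)
  ultimately show ?thesis using X(5) by (simp add: power2_eq_square)
qed

text \<open>Counting covered vertices bounds a matching by half of \<open>n = 2m\<close>; a
  bijection between the sides gives a perfect matching.\<close>

lemma matching_number_complete_bipartite:
  assumes X: "{0..<n} = X \<union> Y" "X \<inter> Y = {}" "card X = m" "card Y = m"
    and arcs: "parcs G = X \<times> Y \<union> Y \<times> X"
  shows "matching_number G = m"
proof (rule antisym)
  have fin: "finite X" "finite Y" by (metis X(1) finite_Un finite_atLeastLessThan)+
  have "card {0..<n} = m + m" unfolding X(1) card_Un_disjoint[OF fin X(2)] X(3,4) ..
  then show "matching_number G \<le> m" using twice_matching_number_le by simp
  obtain f where f: "bij_betw f X Y" using finite_same_card_bij[OF fin] X by auto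
  have fY: "f x \<in> Y" if "x \<in> X" for x using f that by (auto simp: bij_betw_def)
  have f_inj: "x = x'" if "f x = f x'" "x \<in> X" "x' \<in> X" for x x'
    using f that by (auto simp: bij_betw_def inj_on_def)
  have eq: "x = x'" if "x \<in> X" "x' \<in> X" "{x, f x} \<inter> {x', f x'} \<noteq> {}" for x x'
  proof -
    have "f x \<noteq> x'" "x \<noteq> f x'" using that(1,2) fY X(2) by blast+
    then have "x = x' \<or> f x = f x'" using that(3) by blast
    then show ?thesis using f_inj that(1,2) by blast
  qed
  define M where "M = (\<lambda>x. {x, f x}) ` X"
  have "M \<subseteq> uedges G" unfolding M_def uedges_def arcs using fY by blast
  moreover have "disjoint M"
  proof (rule disjointI)
    fix a b assume "a \<in> M" "b \<in> M" "a \<noteq> b"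
    then obtain x x' where x: "x \<in> X" "x' \<in> X" "a = {x, f x}" "b = {x', f x'}" by (auto simp: M_def)
    then have "x \<noteq> x'" using \<open>a \<noteq> b\<close> by metis
    then show "a \<inter> b = {}" using eq[OF x(1,2)] unfolding x(3,4) by metis
  qed
  ultimately have "matching G M" by (simp add: matching_def)
  moreover have "card M = m"
  proof -
    have "inj_on (\<lambda>x. {x, f x}) X" by (rule inj_onI, rule eq) simp_all
    then show ?thesis by (simp add: M_def card_image X(3))
  qed
  ultimately show "m \<le> matching_number G" using card_matching_le by blast
qed

end

text \<open>The bound \<open>n \<ge> 2\<close> excludes the single vertex, whose energy and matching
  number are both 0 although its order is odd.\<close>

theorem theorem4p14:
  fixes n :: nat and G :: "nat pair_pre_digraph" and \<phi> :: "nat \<times> nat \<Rightarrow> complex"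
  assumes "T_gain_graph n (G, \<phi>)"
    and "Digraph_Component.connected (with_proj G)"
    and "bipartite G"
    and "n \<ge> 2"
  shows "energy (G, \<phi>) = 2 * real (matching_number G) \<longleftrightarrow>
    (\<exists>m H. n = 2 * m \<and> pverts H = {0..<n} \<and> complete_bipartite_digraph m m (with_proj H) \<and>
       (G, \<phi>) \<sim>\<^sub>s unit_gain H)"
proof
  interpret T_gain n G \<phi> using assms(1) by unfold_locales
  assume eq: "energy (G, \<phi>) = 2 * real (matching_number G)"
  obtain X Y where XY: "{0..<n} = X \<union> Y" "X \<inter> Y = {}" "parcs G \<subseteq> X \<times> Y \<union> Y \<times> X" "0 \<in> X"
  proof -
    obtain X Y where XY: "{0..<n} = X \<union> Y" "X \<inter> Y = {}" "parcs G \<subseteq> X \<times> Y \<union> Y \<times> X"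
      using assms(3) by (auto simp: bipartite_def verts_G)
    \<comment> \<open>The sides are named so that \<open>X\<close> contains vertex 0, the base
      vertex \<open>p0\<close> of the equality argument.\<close>
    moreover have "0 \<in> X \<union> Y" using assms(4) by (simp flip: XY(1))
    ultimately show thesis using that[of X Y] that[of Y X] by (auto simp: Un_commute Int_commute)
  qed
  note * = equality_imp_complete_bipartite[OF assms(2) XY assms(4) eq]
  have fin: "finite X" "finite Y" by (metis XY(1) finite_Un finite_atLeastLessThan)+
  have "card {0..<n} = card X + card Y" unfolding XY(1) card_Un_disjoint[OF fin XY(2)] ..
  moreover have "complete_bipartite_digraph (card X) (card X) (with_proj G)"
    unfolding complete_bipartite_digraph_pair_def verts_G using * XY(1,2) fin by auto
  ultimately show "\<exists>m H. n = 2 * m \<and> pverts H = {0..<n} \<and> complete_bipartite_digraph m m (with_proj H) \<and>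
       (G, \<phi>) \<sim>\<^sub>s unit_gain H"
    using * verts_G by (intro exI[of _ "card X"] exI[of _ G]) simp
next
  interpret T_gain n G \<phi> using assms(1) by unfold_locales
  assume "\<exists>m H. n = 2 * m \<and> pverts H = {0..<n} \<and> complete_bipartite_digraph m m (with_proj H) \<and>
       (G, \<phi>) \<sim>\<^sub>s unit_gain H"
  then obtain m H X Y where n: "n = 2 * m" and H: "pverts H = {0..<n}" "(G, \<phi>) \<sim>\<^sub>s unit_gain H"
    and XY: "{0..<n} = X \<union> Y" "X \<inter> Y = {}" "card X = m" "card Y = m" and arcs: "parcs H = X \<times> Y \<union> Y \<times> X"
    unfolding complete_bipartite_digraph_pair_def by metis
  have sub: "parcs H \<subseteq> {0..<n} \<times> {0..<n}" unfolding arcs XY(1) by auto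
  obtain u where u: "\<And>p. p < n \<Longrightarrow> cmod (u p) = 1" "parcs H = parcs G"
    "\<And>p q. (p, q) \<in> parcs G \<Longrightarrow> u p * A $$ (p, q) * cnj (u q) = 1"
    using switching_unit_gainD[OF H(2,1) sub] by metis
  have "parcs G = X \<times> Y \<union> Y \<times> X" using u(2) arcs by simp
  moreover have "m > 0" using n assms(4) by simp
  ultimately show "energy (G, \<phi>) = 2 * real (matching_number G)"
    using energy_of_switched_complete_bipartite[OF XY _ _ u(1,3)]
      matching_number_complete_bipartite[OF XY] by simp
qed

end
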